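(* For $n\ge4$, $$\sum_{T\in\mathcal{T}_n}\mathbf{x}^{\mathrm{Des}(T)}=\sum_{\pi\in\mathcal{Z}_n}\mathbf{x}^{\mathrm{Des}(\pi)}.$$
   Context: An interval in $\mathbb{Z}$ is a set $[a,b]=\{a,\dots,b\}$; an interval in $\mathbb{Z}_n$ is a subset of $\{1,\dots,n\}$ of the form $[a,b]$ or $[b,n]\cup[1,a]$ with $1\le a\le b\le n$. A permutation $\pi\in\mathcal{S}_n$ is an arc permutation if every prefix set $\{\pi(1),\dots,\pi(j)\}$, $1\le j\le n$, is an interval in $\mathbb{Z}_n$. It is unimodal if either every prefix set $\{\pi(1),\dots,\pi(j)\}$ or every suffix set $\{\pi(j),\dots,\pi(n)\}$, $1\le j\le n$, is an interval in $\mathbb{Z}$. $\mathcal{A}_n$ and $\mathcal{U}_n\subseteq\mathcal{A}_n$ are the sets of arc and unimodal permutations, and $\mathcal{Z}_n=\mathcal{A}_n\setminus\mathcal{U}_n$ is the set of non-unimodal arc permutations. $\mathcal{T}_n$ is the set of standard Young tableaux of shape $(k,2,1^{n-k-2})$ for some $2\le k\le n-2$. $\mathrm{Des}(\pi)=\{i\in\{1,\dots,n-1\}:\pi(i)>\pi(i+1)\}$. For a standard Young tableau $T$ (English notation, rows from top to bottom), $\mathrm{Des}(T)$ is the set of entries $i$ that lie strictly above the row where $i+1$ lies. For a set $D=\{i_1,\dots,i_k\}$, $\mathbf{x}^D=x_{i_1}\cdots x_{i_k}$, where $x_1,x_2,\dots$ are commuting indeterminates. *)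

theory Defs
  imports "HOL-Combinatorics.Permutations" "HOL-Library.Poly_Mapping"
begin

text \<open>A permutation in \<open>S\<^sub>n\<close> is a function \<open>\<pi> :: nat \<Rightarrow> nat\<close> with \<open>\<pi> permutes {1..n}\<close>.
  All intervals that occur are nonempty and consist of positive integers, so intervals
  in the integers are taken in type \<^typ>\<open>nat\<close>.\<close>

definition interval_Z :: "nat set \<Rightarrow> bool" where
  "interval_Z S \<longleftrightarrow> (\<exists>a b. a \<le> b \<and> S = {a..b})"

definition interval_Zn :: "nat \<Rightarrow> nat set \<Rightarrow> bool" where
  "interval_Zn n S \<longleftrightarrow>
     (\<exists>a b. 1 \<le> a \<and> a \<le> b \<and> b \<le> n \<and> (S = {a..b} \<or> S = {b..n} \<union> {1..a}))"

definition arc_perms :: "nat \<Rightarrow> (nat \<Rightarrow> nat) set" where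
  "arc_perms n = {\<pi>. \<pi> permutes {1..n} \<and> (\<forall>j\<in>{1..n}. interval_Zn n (\<pi> ` {1..j}))}"

definition unimodal_perms :: "nat \<Rightarrow> (nat \<Rightarrow> nat) set" where
  "unimodal_perms n = {\<pi>. \<pi> permutes {1..n} \<and>
     ((\<forall>j\<in>{1..n}. interval_Z (\<pi> ` {1..j})) \<or> (\<forall>j\<in>{1..n}. interval_Z (\<pi> ` {j..n})))}"

definition nonunimodal_arc_perms :: "nat \<Rightarrow> (nat \<Rightarrow> nat) set" where
  "nonunimodal_arc_perms n = arc_perms n - unimodal_perms n"

definition Des_perm :: "nat \<Rightarrow> (nat \<Rightarrow> nat) \<Rightarrow> nat set" where
  "Des_perm n \<pi> = {i \<in> {1..n - 1}. \<pi> i > \<pi> (i + 1)}"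

text \<open>A tableau is the list of its rows, from top to bottom; its shape is the list of
  row lengths. The definition of standardness is meant for \<open>shape\<close> a partition, i.e. a weakly
  decreasing list of positive numbers.\<close>

definition standard_tableaux :: "nat list \<Rightarrow> nat list list set" where
  "standard_tableaux shape = {T.
     map length T = shape \<and>
     distinct (concat T) \<and> set (concat T) = {1..sum_list shape} \<and>
     (\<forall>r < length T. \<forall>c. c + 1 < length (T ! r) \<longrightarrow> T ! r ! c < T ! r ! (c + 1)) \<and>
     (\<forall>r. r + 1 < length T \<longrightarrow>
        (\<forall>c < length (T ! (r + 1)). T ! r ! c < T ! (r + 1) ! c))}"

definition tableaux_T :: "nat \<Rightarrow> nat list list set" where
  "tableaux_T n = (\<Union>k\<in>{2..n - 2}. standard_tableaux (k # 2 # replicate (n - k - 2) 1))"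

definition Des_tab :: "nat list list \<Rightarrow> nat set" where
  "Des_tab T = {i. \<exists>r s. r < s \<and> s < length T \<and> i \<in> set (T ! r) \<and> i + 1 \<in> set (T ! s)}"

text \<open>Polynomials over the integers in the indeterminates \<open>x\<^sub>i\<close>: exponent vectors are finitely
  supported maps \<^typ>\<open>nat \<Rightarrow>\<^sub>0 nat\<close>, and multiplication of \<^typ>\<open>(nat \<Rightarrow>\<^sub>0 nat) \<Rightarrow>\<^sub>0 int\<close>
  is convolution over addition of exponents.\<close>

definition indet :: "nat \<Rightarrow> (nat \<Rightarrow>\<^sub>0 nat) \<Rightarrow>\<^sub>0 int" where
  "indet i = Poly_Mapping.single (Poly_Mapping.single i 1) 1"

definition xpow :: "nat set \<Rightarrow> (nat \<Rightarrow>\<^sub>0 nat) \<Rightarrow>\<^sub>0 int" where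
  "xpow D = (\<Prod>i\<in>D. indet i)"

text \<open>The index sets are finite, so the sums over them have their usual meaning.\<close>

lemma finite_nonunimodal_arc_perms: "finite (nonunimodal_arc_perms n)"
  by (rule finite_subset[OF _ finite_permutations[of "{1..n}"]])
    (auto simp: nonunimodal_arc_perms_def arc_perms_def)

lemma finite_standard_tableaux: "finite (standard_tableaux shape)"
proof -
  let ?N = "{1..sum_list shape}" and ?m = "sum_list shape"
  let ?R = "{xs. set xs \<subseteq> ?N \<and> length xs \<le> ?m}"
  have "finite {T. set T \<subseteq> ?R \<and> length T = length shape}"
    by (intro finite_lists_length_eq finite_lists_length_le) simp
  moreover have "standard_tableaux shape \<subseteq> {T. set T \<subseteq> ?R \<and> length T = length shape}"
    by (auto simp: standard_tableaux_def intro: member_le_sum_list)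
  ultimately show ?thesis by (rule rev_finite_subset)
qed

lemma finite_tableaux_T: "finite (tableaux_T n)"
  by (simp add: tableaux_T_def finite_standard_tableaux)

end

theory Submission imports Defs begin

text \<open>Write a set \<open>D \<subseteq> {1..n - 1}\<close> as a 0-1 word and call \<open>t\<close> a change of \<open>D\<close> if the letters \<open>t - 1\<close> and
  \<open>t\<close> differ. A non-unimodal arc permutation is determined by its descent set and the first position
  \<open>s\<close> at which it takes one of the values \<open>1\<close> and \<open>n\<close>: the prefixes up to \<open>s\<close> and the suffixes after \<open>s\<close>
  are intervals in the integers, and such fillings correspond freely to descent sets. Here \<open>s\<close> runs
  through the changes of the descent set other than the last one. A tableau in \<open>T\<^sub>n\<close> with entry
  \<open>x\<close> in cell \<open>(2,2)\<close> is determined by its descent set and \<open>x - 1\<close>, which runs through the changes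
  other than the first one. So for every \<open>D\<close> both sides count one less than the number of changes
  (or zero).\<close>

subsection \<open>Changes of a set\<close>

definition changes :: "nat \<Rightarrow> nat set \<Rightarrow> nat set" where
  "changes n D = {t \<in> {2..n - 1}. (t - 1 \<in> D) \<noteq> (t \<in> D)}"

lemma finite_changes [simp]: "finite (changes n D)"
  by (simp add: changes_def)

text \<open>A discrete intermediate value argument: while \<open>q - 1\<close> and \<open>q\<close>
  carry the same letter, \<open>q\<close> can be moved left without losing the difference to
  \<open>p\<close>.\<close>

lemma change_between:
  assumes "1 \<le> p" "p < q" "q \<le> n - 1" "(p \<in> D) \<noteq> (q \<in> D)"
  shows "\<exists>t\<in>changes n D. p < t \<and> t \<le> q"
  using assms
proof (induction "q - p" arbitrary: q)
  case (Suc d)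
  show ?case
  proof (cases "(q - 1 \<in> D) = (q \<in> D)")
    case True
    with Suc.prems have "p < q - 1"
      by (metis Suc_diff_1 less_SucE not_less_zero bot_nat_0.not_eq_extremum)
    with Suc True have "\<exists>t\<in>changes n D. p < t \<and> t \<le> q - 1"
      by (intro Suc.hyps) auto
    then show ?thesis by force
  next
    case False
    then show ?thesis using Suc.prems by (intro bexI[of _ q]) (auto simp: changes_def)
  qed
qed simp

text \<open>If \<open>A\<close> is nonempty, one side drops exactly \<open>Max A\<close> and the
  other exactly \<open>Min A\<close>. This is what lets "not the last change" be traded for "not the
  first change".\<close>

lemma card_nonmax_eq_card_nonmin:
  fixes A :: "'a :: linorder set"
  assumes "finite A"
  shows "card {x \<in> A. \<exists>y\<in>A. x < y} = card {x \<in> A. \<exists>y\<in>A. y < x}"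
proof (cases "A = {}")
  case False
  have "{x \<in> A. \<exists>y\<in>A. x < y} = A - {Max A}"
    using assms False by (fastforce dest: Max_ge intro: Max_in bexI[of _ "Max A"])
  moreover have "{x \<in> A. \<exists>y\<in>A. y < x} = A - {Min A}"
    using assms False by (fastforce dest: Min_le intro: Min_in bexI[of _ "Min A"])
  ultimately show ?thesis using assms False by simp
qed simp

text \<open>The summand ignores \<open>s\<close>, so only the number of admissible \<open>s\<close>
  for each \<open>D\<close> matters.\<close>

lemma sum_nonlast_changes_eq:
  fixes F :: "nat set \<Rightarrow> 'a :: semiring_1"
  shows "(\<Sum>(D, s)\<in>(SIGMA D:Pow {1..n - 1}. {s \<in> changes n D. \<exists>t\<in>changes n D. t < s}). F D) =
    (\<Sum>(D, s)\<in>(SIGMA D:Pow {1..n - 1}. {s \<in> changes n D. \<exists>t\<in>changes n D. s < t}). F D)"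
  by (subst (1 2) sum.Sigma[symmetric]) (auto simp: card_nonmax_eq_card_nonmin)

subsection \<open>Sequences whose prefixes are intervals\<close>

text \<open>The offset \<open>a\<close> is kept variable because removing the last position shifts
  the remaining block of values by one whenever the removed value was the smallest. Only the part of
  \<open>D\<close> below \<open>s\<close> is consulted.\<close>

definition prefix_filling :: "nat \<Rightarrow> nat \<Rightarrow> nat set \<Rightarrow> (nat \<Rightarrow> nat) \<Rightarrow> bool" where
  "prefix_filling a s D f \<longleftrightarrow>
     bij_betw f {1..s} {a + 1..a + s} \<and>
     (\<forall>j\<in>{1..s}. interval_Z (f ` {1..j})) \<and>
     (\<forall>i\<in>{1..<s}. f (i + 1) < f i \<longleftrightarrow> i \<in> D)"

text \<open>The first \<open>s\<close> values form an interval of size \<open>s\<close> inside a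
  block of size \<open>s + 1\<close>, so they miss one end of the block. The last value is that end,
  and comparing it with \<open>f s\<close> tells which end it is.\<close>

lemma prefix_filling_last:
  assumes bij: "bij_betw f {1..Suc s} {a + 1..a + Suc s}"
    and int: "interval_Z (f ` {1..s})" and s: "1 \<le> s"
  shows "if f (Suc s) < f s
    then f (Suc s) = a + 1 \<and> f ` {1..s} = {a + 2..a + Suc s}
    else f (Suc s) = a + Suc s \<and> f ` {1..s} = {a + 1..a + s}"
proof -
  obtain l u where lu: "l \<le> u" "f ` {1..s} = {l..u}"
    using int by (auto simp: interval_Z_def)
  have fs: "f s \<in> {l..u}" using lu s by auto
  have S: "{1..Suc s} = insert (Suc s) {1..s}" by auto
  have inj: "inj_on f {1..Suc s}" and im: "f ` {1..Suc s} = {a + 1..a + Suc s}"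
    using bij by (auto simp: bij_betw_def)
  have notin: "f (Suc s) \<notin> {l..u}"
    using inj unfolding S by (subst lu(2)[symmetric]) (simp add: inj_on_insert)
  have eq: "insert (f (Suc s)) {l..u} = {a + 1..a + Suc s}"
    using im unfolding S image_insert lu(2) .
  have sub: "l \<ge> a + 1" "u \<le> a + Suc s"
    using eq lu(1) by (metis atLeastAtMost_iff insertCI order_refl)+
  have mem: "f (Suc s) \<ge> a + 1" "f (Suc s) \<le> a + Suc s"
    using eq by (metis atLeastAtMost_iff insertCI)+
  have "card {l..u} = s"
    using card_image[OF inj_on_subset[OF inj, of "{1..s}"]] lu by simp
  then have "u + 1 = l + s" using lu(1) by simp
  then consider "l = a + 1" "u = a + s" | "l = a + 2" "u = a + Suc s"
    using sub lu(1) s by fastforce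
  then show ?thesis
  proof cases
    case 1
    then have "f (Suc s) = a + Suc s" using mem notin by auto
    then show ?thesis using 1 lu fs by auto
  next
    case 2
    then have "f (Suc s) = a + 1" using mem notin by auto
    then show ?thesis using 2 lu fs by auto
  qed
qed

text \<open>The recursion behind uniqueness: the descent set alone dictates the last value and the
  offset of what remains.\<close>

lemma prefix_filling_SucD:
  assumes "prefix_filling a (Suc s) D f" "1 \<le> s"
  shows "if s \<in> D then f (Suc s) = a + 1 \<and> prefix_filling (a + 1) s D f
    else f (Suc s) = a + Suc s \<and> prefix_filling a s D f"
proof -
  have des: "f (Suc s) < f s \<longleftrightarrow> s \<in> D"
    and inj: "inj_on f {1..s}"
    using assms by (auto simp: prefix_filling_def bij_betw_def intro: inj_on_subset)
  have last: "if f (Suc s) < f s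
    then f (Suc s) = a + 1 \<and> f ` {1..s} = {a + 2..a + Suc s}
    else f (Suc s) = a + Suc s \<and> f ` {1..s} = {a + 1..a + s}"
    using assms by (intro prefix_filling_last) (auto simp: prefix_filling_def)
  show ?thesis
    using last inj assms unfolding des prefix_filling_def bij_betw_def by (auto split: if_splits)
qed

lemma prefix_filling_unique:
  assumes "prefix_filling a s D f" "prefix_filling a s D g" "i \<in> {1..s}"
  shows "f i = g i"
  using assms
proof (induction s arbitrary: a i)
  case (Suc s)
  show ?case
  \<comment> \<open>With a single position there is no comparison to read off, but the block then
    has only one value.\<close>
  proof (cases "s = 0")
    case True
    then show ?thesis using Suc.prems by (auto simp: prefix_filling_def bij_betw_def)
  next
    case False
    then show ?thesis
      using prefix_filling_SucD[OF Suc.prems(1)] prefix_filling_SucD[OF Suc.prems(2)]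
        Suc.IH[of a i] Suc.IH[of "a + 1" i] Suc.prems(3)
      by (cases "i = Suc s") (auto split: if_splits)
  qed
qed simp

lemma prefix_filling_exists: "\<exists>f. prefix_filling a s D f"
proof (induction s arbitrary: a)
  case 0
  show ?case by (auto simp: prefix_filling_def)
next
  case (Suc s)
  \<comment> \<open>Reverses the peeling: the new value \<open>v\<close> goes just below the block
    of earlier values at a descent and just above it at an ascent, and \<open>a'\<close> leaves room
    for it.\<close>
  define a' v where "a' = (if s \<in> D then a + 1 else a)" and "v = (if s \<in> D then a + 1 else a + Suc s)"
  obtain f where f: "prefix_filling a' s D f" using Suc.IH by blast
  let ?g = "f(Suc s := v)"
  have im: "?g ` {1..j} = f ` {1..j}" if "j \<le> s" for j
    using that by (intro image_cong) auto
  have fim: "f ` {1..s} = {a' + 1..a' + s}" "inj_on f {1..s}"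
    using f by (auto simp: prefix_filling_def bij_betw_def)
  have S: "{1..Suc s} = insert (Suc s) {1..s}" by auto
  have all: "?g ` {1..Suc s} = {a + 1..a + Suc s}"
    using im[of s] fim unfolding S image_insert by (auto simp: a'_def v_def)
  have "v \<notin> f ` {1..s}" using fim by (auto simp: a'_def v_def)
  then have "inj_on ?g {1..Suc s}"
    using fim(2) im[of s] unfolding S inj_on_insert
    by (simp add: inj_on_fun_updI)
  then have "bij_betw ?g {1..Suc s} {a + 1..a + Suc s}"
    using all by (simp only: bij_betw_def simp_thms)
  moreover have "interval_Z (?g ` {1..j})" if "j \<in> {1..Suc s}" for j
  proof (cases "j = Suc s")
    case True
    then show ?thesis using all by (auto simp: interval_Z_def intro!: exI[of _ "Suc a"] exI[of _ "Suc (a + s)"])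
  next
    case False
    then show ?thesis using that f im[of j] by (auto simp: prefix_filling_def)
  qed
  moreover have "?g (i + 1) < ?g i \<longleftrightarrow> i \<in> D" if "i \<in> {1..<Suc s}" for i
  proof (cases "i = s")
    case True
    then have "f s \<in> {a' + 1..a' + s}" using that fim(1) by auto
    then show ?thesis using True by (auto simp: a'_def v_def)
  next
    case False
    then show ?thesis using that f by (auto simp: prefix_filling_def)
  qed
  ultimately have "prefix_filling a (Suc s) D ?g" by (simp only: prefix_filling_def) blast
  then show ?case by blast
qed

text \<open>Used to see that the first block of a split permutation ends in \<open>1\<close> or
  \<open>n\<close>.\<close>

lemma prefix_filling_last_value:
  assumes "prefix_filling a s D f" "2 \<le> s"
  shows "f s = (if s - 1 \<in> D then a + 1 else a + s)"
proof -
  obtain s' where "s = Suc s'" "1 \<le> s'" using assms(2) by (cases s) auto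
  then show ?thesis using prefix_filling_SucD[of a s' D f] assms(1) by auto
qed

subsection \<open>Arc permutations\<close>

lemma interval_Z_eqI:
  assumes "interval_Z S" "S \<subseteq> {1..n}" "card S = s"
  shows "n \<in> S \<Longrightarrow> S = {n - s + 1..n}" and "1 \<in> S \<Longrightarrow> S = {1..s}"
proof -
  obtain l u where lu: "l \<le> u" "S = {l..u}" using assms(1) by (auto simp: interval_Z_def)
  have "l \<in> S" "u \<in> S" using lu by auto
  then have b: "1 \<le> l" "u \<le> n" using assms(2) by auto
  have c: "s = u + 1 - l" using assms(3) lu by simp
  show "S = {n - s + 1..n}" if "n \<in> S" using that b c lu by auto
  show "S = {1..s}" if "1 \<in> S" using that b c lu by auto
qed

text \<open>An arc that lacks \<open>1\<close> or \<open>n\<close> is an integer interval, and so is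
  the complement of a proper arc that contains \<open>1\<close> or \<open>n\<close>. Hence cutting
  an arc permutation right after its first extreme value turns the cyclic condition into two integer
  ones.\<close>

definition split_arc_perm :: "nat \<Rightarrow> nat \<Rightarrow> (nat \<Rightarrow> nat) \<Rightarrow> bool" where
  "split_arc_perm n s \<pi> \<longleftrightarrow> \<pi> permutes {1..n} \<and> \<pi> s \<in> {1, n} \<and>
     (\<forall>j\<in>{1..s}. interval_Z (\<pi> ` {1..j})) \<and> (\<forall>j\<in>{s + 1..n}. interval_Z (\<pi> ` {j..n}))"

lemma permutes_prefix:
  fixes \<pi> :: "nat \<Rightarrow> nat"
  assumes "\<pi> permutes {1..n}" "j \<le> n"
  shows "\<pi> ` {1..j} \<subseteq> {1..n}" "card (\<pi> ` {1..j}) = j"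
proof -
  show "\<pi> ` {1..j} \<subseteq> {1..n}"
    using permutes_image[OF assms(1)] assms(2) by (metis atLeastatMost_subset_iff image_mono order_refl)
  show "card (\<pi> ` {1..j}) = j"
    using permutes_inj[OF assms(1)] by (subst card_image) (auto intro: inj_on_subset)
qed

lemma permutes_suffix:
  fixes \<pi> :: "nat \<Rightarrow> nat"
  assumes "\<pi> permutes {1..n}" "j \<le> n"
  shows "\<pi> ` {j + 1..n} = {1..n} - \<pi> ` {1..j}"
proof -
  have "{j + 1..n} = {1..n} - {1..j}" by auto
  then show ?thesis
    using permutes_image[OF assms(1)] image_set_diff[OF permutes_inj[OF assms(1)]] by metis
qed

lemma rev_image: "j \<le> n \<Longrightarrow> (\<lambda>i. \<pi> (n + 1 - i)) ` {1..j} = \<pi> ` {n + 1 - j..n}" for n j :: nat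
proof -
  assume "j \<le> n"
  have "(\<lambda>i. n + 1 - i) ` {1..j} = {n + 1 - j..n}"
  proof (intro subset_antisym subsetI)
    fix x assume "x \<in> {n + 1 - j..n}"
    then show "x \<in> (\<lambda>i. n + 1 - i) ` {1..j}"
      by (intro image_eqI[of _ _ "n + 1 - x"]) auto
  qed (use \<open>j \<le> n\<close> in auto)
  then show ?thesis by (metis image_image)
qed

text \<open>If \<open>s\<close> is a descent then \<open>\<pi> s = n\<close> and the first block takes the \<open>s\<close> largest values, otherwise
  \<open>\<pi> s = 1\<close> and it takes the \<open>s\<close> smallest ones. Read backwards, the second block is again a prefix
  filling, with ascents and descents exchanged.\<close>

lemma split_arc_perm_iff_fillings:
  assumes s: "2 \<le> s" "s + 1 \<le> n" and D: "D \<subseteq> {1..n - 1}" and change: "(s - 1 \<in> D) \<noteq> (s \<in> D)"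
    and perm: "\<pi> permutes {1..n}"
  shows "split_arc_perm n s \<pi> \<and> Des_perm n \<pi> = D \<longleftrightarrow>
    prefix_filling (if s \<in> D then n - s else 0) s D \<pi> \<and>
    prefix_filling (if s \<in> D then 0 else s) (n - s) {k. n - k \<notin> D} (\<lambda>i. \<pi> (n + 1 - i))"
    (is "_ \<longleftrightarrow> prefix_filling ?a s D \<pi> \<and> prefix_filling ?b _ ?D' ?\<rho>")
proof (intro iffI conjI)
  have inj: "inj \<pi>" using perm by (rule permutes_inj)
  have val: "\<pi> i \<in> {1..n}" if "i \<in> {1..n}" for i using permutes_in_image[OF perm] that by blast
  note prefix = permutes_prefix[OF perm, of s]
  {
    assume "split_arc_perm n s \<pi> \<and> Des_perm n \<pi> = D"
    then have split: "split_arc_perm n s \<pi>" and Des: "Des_perm n \<pi> = D" by auto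
    have des: "\<pi> (i + 1) < \<pi> i \<longleftrightarrow> i \<in> D" if "i \<in> {1..n - 1}" for i
      using that unfolding Des[symmetric] Des_perm_def by auto
    have int: "interval_Z (\<pi> ` {1..s})" and mem: "\<pi> s \<in> \<pi> ` {1..s}"
      using split s by (auto simp: split_arc_perm_def)
    have im: "\<pi> ` {1..s} = {?a + 1..?a + s}"
    proof (cases "s \<in> D")
      case True
      then have "\<pi> (s + 1) < \<pi> s" using des[of s] s by auto
      then have "\<pi> s = n" using split val[of "s + 1"] s by (auto simp: split_arc_perm_def)
      then have "\<pi> ` {1..s} = {n - s + 1..n}"
        using int prefix mem s by (intro interval_Z_eqI) auto
      then show ?thesis using True s by simp
    next
      case False
      \<comment> \<open>Since \<open>s\<close> is a change and not a descent, \<open>s - 1\<close>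
        is a descent. This rules out \<open>\<pi> s = n\<close>.\<close>
      have "s - 1 \<in> {1..n - 1}" using s by auto
      from des[OF this] False change s have "\<pi> s < \<pi> (s - 1)" by simp
      moreover have "s - 1 \<in> {1..n}" using s by auto
      note val[OF this]
      ultimately have "\<pi> s = 1" using split by (auto simp: split_arc_perm_def)
      then have "\<pi> ` {1..s} = {1..s}"
        using int prefix mem s by (intro interval_Z_eqI) auto
      then show ?thesis using False s by simp
    qed
    show "prefix_filling ?a s D \<pi>"
      unfolding prefix_filling_def bij_betw_def
      using im split des s inj_on_subset[OF inj]
      by (auto simp: split_arc_perm_def)
    have "?\<rho> ` {1..n - s} = \<pi> ` {s + 1..n}" using s by (subst rev_image) auto
    also have "\<dots> = {1..n} - {?a + 1..?a + s}" using permutes_suffix[OF perm, of s] im s by simp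
    also have "\<dots> = {?b + 1..?b + (n - s)}" using s by auto
    finally have im': "?\<rho> ` {1..n - s} = {?b + 1..?b + (n - s)}" .
    have "inj_on ?\<rho> {1..n - s}"
      using s by (intro inj_onI) (auto dest!: injD[OF inj])
    moreover have "interval_Z (?\<rho> ` {1..j})" if "j \<in> {1..n - s}" for j
    proof -
      have "n + 1 - j \<in> {s + 1..n}" using that by auto
      then have "interval_Z (\<pi> ` {n + 1 - j..n})" using split by (simp only: split_arc_perm_def)
      then show ?thesis using that by (subst rev_image) auto
    qed
    moreover have "?\<rho> (i + 1) < ?\<rho> i \<longleftrightarrow> i \<in> ?D'" if "i \<in> {1..<n - s}" for i
    proof -
      have "\<pi> (n - i) \<noteq> \<pi> (n - i + 1)" using injD[OF inj, of "n - i" "n - i + 1"] by auto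
      moreover have "n + 1 - i = n - i + 1" using that by auto
      moreover have "n - i \<in> {1..n - 1}" using that by auto
      note des[OF this]
      ultimately show ?thesis using that by auto
    qed
    ultimately show "prefix_filling ?b (n - s) ?D' ?\<rho>"
      using im' unfolding prefix_filling_def bij_betw_def by blast
  }
  assume R: "prefix_filling ?a s D \<pi> \<and> prefix_filling ?b (n - s) ?D' ?\<rho>"
  \<comment> \<open>By \<open>change\<close>, the step into \<open>s\<close> is opposite to the step
    out of it. So the last value is the top of the upper block if \<open>s \<in> D\<close> and the
    bottom of the lower block otherwise.\<close>
  have "\<pi> s \<in> {1, n}"
    using prefix_filling_last_value[of ?a s D \<pi>] R s change by auto
  moreover have "interval_Z (\<pi> ` {j..n})" if "j \<in> {s + 1..n}" for j
  proof -
    have "n + 1 - j \<in> {1..n - s}" using that by auto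
    then have "interval_Z (?\<rho> ` {1..n + 1 - j})"
      using R unfolding prefix_filling_def by blast
    then show ?thesis using that by (subst (asm) rev_image) auto
  qed
  ultimately show "split_arc_perm n s \<pi>"
    using perm R by (auto simp: split_arc_perm_def prefix_filling_def)
  have first: "\<pi> s \<in> {?a + 1..?a + s}"
    using R s by (auto simp: prefix_filling_def bij_betw_def)
  have "?\<rho> ` {1..n - s} = {?b + 1..?b + (n - s)}"
    using R by (auto simp: prefix_filling_def bij_betw_def)
  moreover have "\<pi> (s + 1) \<in> ?\<rho> ` {1..n - s}" using s by (intro image_eqI[of _ _ "n - s"]) auto
  ultimately have second: "\<pi> (s + 1) \<in> {?b + 1..?b + (n - s)}" by simp
  have "i \<in> Des_perm n \<pi> \<longleftrightarrow> i \<in> D" if i: "i \<in> {1..n - 1}" for i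
  proof -
    consider "i < s" | "i = s" | "i > s" by linarith
    then show ?thesis
    proof cases
      case 1
      then show ?thesis using R i by (auto simp: Des_perm_def prefix_filling_def)
    next
      case 2
      \<comment> \<open>The step at \<open>s\<close> crosses from one block of values to the other,
        and the first block is the upper one exactly when \<open>s \<in> D\<close>.\<close>
      then show ?thesis using first second i by (cases "s \<in> D") (auto simp: Des_perm_def)
    next
      case 3
      \<comment> \<open>In the reversed block the step between positions \<open>i\<close> and
        \<open>i + 1\<close> has index \<open>n - i\<close> and the opposite direction, which
        explains the complement in \<open>?D'\<close>.\<close>
      have "n - i \<in> {1..<n - s}" using 3 i by auto
      then have "?\<rho> (n - i + 1) < ?\<rho> (n - i) \<longleftrightarrow> n - i \<in> ?D'"
        using R unfolding prefix_filling_def by blast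
      moreover have "n + 1 - (n - i + 1) = i" "n + 1 - (n - i) = i + 1" "n - (n - i) = i"
        using i by auto
      moreover have "\<pi> i \<noteq> \<pi> (i + 1)" using injD[OF inj, of i "i + 1"] by auto
      ultimately show ?thesis using i by (auto simp: Des_perm_def)
    qed
  qed
  moreover have "Des_perm n \<pi> \<subseteq> {1..n - 1}" by (auto simp: Des_perm_def)
  ultimately show "Des_perm n \<pi> = D" using D by blast
qed

text \<open>By the equivalence above, \<open>s\<close> and the descent set prescribe both fillings,
  and each filling is unique on its block.\<close>

lemma split_arc_perm_unique:
  assumes "2 \<le> s" "s + 1 \<le> n" "(s - 1 \<in> Des_perm n \<pi>) \<noteq> (s \<in> Des_perm n \<pi>)"
    and "split_arc_perm n s \<pi>" "split_arc_perm n s \<sigma>" "Des_perm n \<sigma> = Des_perm n \<pi>"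
  shows "\<sigma> = \<pi>"
proof
  fix i
  let ?D = "Des_perm n \<pi>"
  have D: "?D \<subseteq> {1..n - 1}" by (auto simp: Des_perm_def)
  have perm: "\<pi> permutes {1..n}" "\<sigma> permutes {1..n}" using assms by (auto simp: split_arc_perm_def)
  let ?a = "if s \<in> ?D then n - s else 0" and ?b = "if s \<in> ?D then 0 else s"
    and ?D' = "{k. n - k \<notin> ?D}"
  have F: "prefix_filling ?a s ?D \<tau> \<and> prefix_filling ?b (n - s) ?D' (\<lambda>i. \<tau> (n + 1 - i))"
    if "\<tau> \<in> {\<pi>, \<sigma>}" for \<tau>
    using that perm assms(4-6) split_arc_perm_iff_fillings[OF assms(1,2) D assms(3), of \<tau>] by blast
  consider "i \<notin> {1..n}" | "i \<in> {1..s}" | "i \<in> {s + 1..n}" by fastforce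
  then show "\<sigma> i = \<pi> i"
  proof cases
    case 1
    then show ?thesis using perm by (metis permutes_not_in)
  next
    case 2
    then show ?thesis using prefix_filling_unique F[of \<sigma>] F[of \<pi>] by blast
  next
    case 3
    then have "n + 1 - i \<in> {1..n - s}" by auto
    then have "\<sigma> (n + 1 - (n + 1 - i)) = \<pi> (n + 1 - (n + 1 - i))"
      using prefix_filling_unique[of ?b "n - s" ?D' "\<lambda>i. \<sigma> (n + 1 - i)" "\<lambda>i. \<pi> (n + 1 - i)" "n + 1 - i"]
        F[of \<sigma>] F[of \<pi>] by blast
    then show ?thesis using 3 by simp
  qed
qed

lemma prefix_filling_cong:
  assumes "\<And>i. i \<in> {1..s} \<Longrightarrow> f i = g i"
  shows "prefix_filling a s D f \<longleftrightarrow> prefix_filling a s D g"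
proof -
  have "f ` {1..j} = g ` {1..j}" if "j \<in> {1..s}" for j
    using that assms by (intro image_cong) auto
  moreover have "bij_betw f {1..s} A \<longleftrightarrow> bij_betw g {1..s} A" for A
    using assms by (intro bij_betw_cong) auto
  ultimately show ?thesis using assms by (auto simp: prefix_filling_def)
qed

lemma split_arc_perm_exists:
  assumes s: "2 \<le> s" "s + 1 \<le> n" and D: "D \<subseteq> {1..n - 1}" and change: "(s - 1 \<in> D) \<noteq> (s \<in> D)"
  shows "\<exists>\<pi>. split_arc_perm n s \<pi> \<and> Des_perm n \<pi> = D"
proof -
  define a where "a = (if s \<in> D then n - s else 0)"
  define b where "b = (if s \<in> D then 0 else s)"
  obtain f where f: "prefix_filling a s D f" using prefix_filling_exists by blast
  obtain g where g: "prefix_filling b (n - s) {k. n - k \<notin> D} g" using prefix_filling_exists by blast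
  \<comment> \<open>The two fillings are glued, the second one written backwards. Outside
    \<open>{1..n}\<close> the identity is required by \<open>permutes\<close>.\<close>
  define \<pi> where "\<pi> i = (if i \<in> {1..s} then f i else if i \<in> {s + 1..n} then g (n + 1 - i) else i)" for i
  have f\<pi>: "prefix_filling a s D \<pi>"
    using f by (subst prefix_filling_cong[of _ _ f]) (auto simp: \<pi>_def)
  have g\<pi>: "prefix_filling b (n - s) {k. n - k \<notin> D} (\<lambda>i. \<pi> (n + 1 - i))"
    using g by (subst prefix_filling_cong[of _ _ g]) (auto simp: \<pi>_def)
  have "\<pi> ` {s + 1..n} = (\<lambda>i. \<pi> (n + 1 - i)) ` {1..n - s}"
    using s by (subst rev_image) auto
  then have "\<pi> ` {s + 1..n} = {b + 1..b + (n - s)}"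
    using g\<pi> by (auto simp: prefix_filling_def bij_betw_def)
  moreover have "\<pi> ` {1..s} = {a + 1..a + s}"
    using f\<pi> by (auto simp: prefix_filling_def bij_betw_def)
  moreover have "{1..n} = {1..s} \<union> {s + 1..n}" using s by auto
  ultimately have "\<pi> ` {1..n} = {a + 1..a + s} \<union> {b + 1..b + (n - s)}"
    by (simp only: image_Un)
  also have "\<dots> = {1..n}" using s by (auto simp: a_def b_def)
  finally have im: "\<pi> ` {1..n} = {1..n}" .
  then have "inj_on \<pi> {1..n}" by (intro eq_card_imp_inj_on) auto
  with im have perm: "\<pi> permutes {1..n}"
    using s by (intro bij_imp_permutes) (auto simp: bij_betw_def \<pi>_def)
  show ?thesis
    using split_arc_perm_iff_fillings[OF s D change perm] f\<pi> g\<pi> by (auto simp: a_def b_def)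
qed

section \<open>Integer intervals, arcs of the cycle and their complements\<close>

lemma interval_Z_between:
  "interval_Z S \<Longrightarrow> x \<in> S \<Longrightarrow> z \<in> S \<Longrightarrow> x \<le> y \<Longrightarrow> y \<le> z \<Longrightarrow> y \<in> S"
  by (auto simp: interval_Z_def)

lemma interval_Zn_intros:
  assumes "1 \<le> a" "a \<le> b" "b \<le> n"
  shows "interval_Zn n {a..b}" "interval_Zn n ({b..n} \<union> {1..a})"
  using assms unfolding interval_Zn_def by blast+

lemma interval_Z_intro: "a \<le> b \<Longrightarrow> interval_Z {a..b}"
  unfolding interval_Z_def by blast

lemma interval_Zn_of_interval_Z:
  assumes "interval_Z S" "S \<subseteq> {1..n}" shows "interval_Zn n S"
proof -
  obtain l u where lu: "l \<le> u" "S = {l..u}" using assms(1) by (auto simp: interval_Z_def)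
  then have "l \<in> {1..n}" "u \<in> {1..n}" using assms(2) by auto
  with lu show ?thesis by (auto simp: interval_Zn_def)
qed

text \<open>Removing an initial or a final piece of \<open>{1..n}\<close> leaves an integer
  interval; removing an inner piece leaves an arc that wraps around.\<close>

lemma interval_Zn_compl:
  assumes "interval_Z S" "S \<subseteq> {1..n}" "S \<noteq> {1..n}" shows "interval_Zn n ({1..n} - S)"
proof -
  obtain l u where lu: "l \<le> u" "S = {l..u}" using assms(1) by (auto simp: interval_Z_def)
  then have b: "1 \<le> l" "u \<le> n" using assms(2) by auto
  consider "l = 1" | "u = n" "l > 1" | "l > 1" "u < n" using b by linarith
  then show ?thesis
  proof cases
    case 1
    then have "{1..n} - S = {u + 1..n}" "u < n" using lu b assms(3) by auto
    then show ?thesis by (simp add: interval_Zn_intros)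
  next
    case 2
    then have "{1..n} - S = {1..l - 1}" using lu b by auto
    then show ?thesis using 2 lu(1) by (simp add: interval_Zn_intros)
  next
    case 3
    then have "{1..n} - S = {u + 1..n} \<union> {1..l - 1}" using lu b by auto
    moreover have "interval_Zn n ({u + 1..n} \<union> {1..l - 1})"
      using 3 lu(1) by (intro interval_Zn_intros) auto
    ultimately show ?thesis by simp
  qed
qed

lemma interval_Zn_cases:
  assumes "interval_Zn n S" "1 \<notin> S \<or> n \<notin> S"
  shows "interval_Z S"
  using assms by (auto simp: interval_Zn_def interval_Z_def)

text \<open>An arc that does not wrap around but contains \<open>1\<close> or \<open>n\<close> is an
  initial or a final piece. An arc that wraps around leaves the gap between its two pieces.\<close>

lemma interval_Zn_compl_cases:
  assumes "interval_Zn n S" "1 \<in> S \<or> n \<in> S" "S \<noteq> {1..n}"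
  shows "interval_Z ({1..n} - S)"
proof -
  obtain a b where ab: "1 \<le> a" "a \<le> b" "b \<le> n" and S: "S = {a..b} \<or> S = {b..n} \<union> {1..a}"
    using assms(1) by (auto simp: interval_Zn_def)
  from S show ?thesis
  proof
    assume S: "S = {a..b}"
    then consider "a = 1" "b < n" | "b = n" "1 < a" using ab assms(2,3) by fastforce
    then show ?thesis
    proof cases
      case 1
      then have "{1..n} - S = {b + 1..n}" using S by auto
      then show ?thesis using 1 by (simp add: interval_Z_intro)
    next
      case 2
      then have "{1..n} - S = {1..a - 1}" using S ab by auto
      then show ?thesis using 2 by (simp add: interval_Z_intro)
    qed
  next
    assume S: "S = {b..n} \<union> {1..a}"
    \<comment> \<open>Otherwise the two pieces meet or are adjacent and cover all of
      \<open>{1..n}\<close>.\<close>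
    have "\<not> b \<le> a + 1" using S ab assms(3) by auto
    moreover have "{1..n} - S = {a + 1..b - 1}" using S ab by auto
    ultimately show ?thesis by (simp add: interval_Z_intro)
  qed
qed

lemma interval_Z_full:
  assumes "interval_Z S" "S \<subseteq> {1..n}" "1 \<in> S" "n \<in> S"
  shows "S = {1..n}"
  using assms interval_Z_between[OF assms(1,3,4)] by auto

section \<open>Split permutations with a later change are the non-unimodal arc permutations\<close>

lemma split_arc_perm_in_arc_perms:
  assumes split: "split_arc_perm n s \<pi>"
  shows "\<pi> \<in> arc_perms n"
proof -
  have perm: "\<pi> permutes {1..n}" using split by (auto simp: split_arc_perm_def)
  have "interval_Zn n (\<pi> ` {1..j})" if j: "j \<in> {1..n}" for j
  proof (cases "j \<le> s")
    case True
    then have "interval_Z (\<pi> ` {1..j})" using split j unfolding split_arc_perm_def by simp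
    then show ?thesis using permutes_prefix(1)[OF perm] j by (intro interval_Zn_of_interval_Z) auto
  next
    case False
    show ?thesis
    proof (cases "j = n")
      case True
      then show ?thesis using permutes_image[OF perm] j interval_Zn_intros(1)[of 1 n n] by simp
    next
      case j': False
      \<comment> \<open>A prefix longer than \<open>s\<close> is handled through its complement, a
        suffix starting after \<open>s\<close> and therefore an integer interval.\<close>
      have eq: "\<pi> ` {j + 1..n} = {1..n} - \<pi> ` {1..j}" using permutes_suffix[OF perm] j by simp
      have "interval_Z (\<pi> ` {j + 1..n})"
        using split False j j' by (auto simp: split_arc_perm_def)
      moreover have "\<pi> ` {j + 1..n} \<subseteq> {1..n}" using eq by blast
      moreover have "\<pi> j \<in> {1..n} - \<pi> ` {j + 1..n}"
        using permutes_in_image[OF perm, of j] j unfolding eq by auto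
      then have "\<pi> ` {j + 1..n} \<noteq> {1..n}" by blast
      ultimately have "interval_Zn n ({1..n} - \<pi> ` {j + 1..n})" using interval_Zn_compl by blast
      then show ?thesis
        using eq permutes_prefix(1)[OF perm, of j] j by (simp add: double_diff)
    qed
  qed
  with perm show ?thesis by (auto simp: arc_perms_def)
qed

text \<open>A second extreme value among the first \<open>s\<close> would put both \<open>1\<close>
  and \<open>n\<close> into an interval of only \<open>s < n\<close> elements. It follows that
  \<open>s\<close> can be recovered from \<open>\<pi>\<close>.\<close>

lemma split_arc_perm_prefix_proper:
  assumes "split_arc_perm n s \<pi>" "s < n" "i \<in> {1..s}" "\<pi> i \<in> {1, n}" "1 \<le> s"
  shows "i = s"
proof (rule ccontr)
  assume "i \<noteq> s"
  have perm: "\<pi> permutes {1..n}" using assms by (auto simp: split_arc_perm_def)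
  have "\<pi> i \<noteq> \<pi> s" using \<open>i \<noteq> s\<close> injD[OF permutes_inj[OF perm]] by blast
  moreover have "\<pi> s \<in> {1, n}" using assms(1) by (simp add: split_arc_perm_def)
  ultimately have "\<pi> i = 1 \<and> \<pi> s = n \<or> \<pi> i = n \<and> \<pi> s = 1" using assms(4) by auto
  moreover have "\<pi> i \<in> \<pi> ` {1..s}" "\<pi> s \<in> \<pi> ` {1..s}" using assms(3,5) by auto
  ultimately have "1 \<in> \<pi> ` {1..s}" "n \<in> \<pi> ` {1..s}" by auto
  then have "\<pi> ` {1..s} = {1..n}"
    using assms permutes_prefix(1)[OF perm, of s]
    by (intro interval_Z_full) (auto simp: split_arc_perm_def)
  then show False using permutes_prefix(2)[OF perm, of s] assms by auto
qed

lemma split_arc_perm_position_unique: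
  assumes "split_arc_perm n s \<pi>" "split_arc_perm n s' \<pi>" "s \<in> {1..<n}" "s' \<in> {1..<n}"
  shows "s = s'"
proof (cases "s \<le> s'")
  case True
  then show ?thesis
    using split_arc_perm_prefix_proper[of n s' \<pi> s] assms by (auto simp: split_arc_perm_def)
next
  case False
  then show ?thesis
    using split_arc_perm_prefix_proper[of n s \<pi> s'] assms by (auto simp: split_arc_perm_def)
qed

text \<open>If all prefixes were intervals, every step after the extreme value
  \<open>\<pi> s\<close> would run in the same direction, so no change could follow
  \<open>s\<close>. If all suffixes were intervals, the suffix from \<open>s\<close> on would
  contain both \<open>1\<close> and \<open>n\<close> and be everything, against
  \<open>2 \<le> s\<close>.\<close>

lemma split_arc_perm_nonunimodal:
  assumes split: "split_arc_perm n s \<pi>" and s: "2 \<le> s"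
    and t: "t \<in> changes n (Des_perm n \<pi>)" "s < t"
  shows "\<pi> \<in> nonunimodal_arc_perms n"
proof -
  have perm: "\<pi> permutes {1..n}" using split by (auto simp: split_arc_perm_def)
  have inj: "inj \<pi>" using perm by (rule permutes_inj)
  have val: "\<pi> i \<in> {1..n}" if "i \<in> {1..n}" for i using permutes_in_image[OF perm] that by blast
  have tn: "t \<le> n - 1" "s < n" using t by (auto simp: changes_def)
  have "\<pi> \<notin> unimodal_perms n"
  proof
    assume "\<pi> \<in> unimodal_perms n"
    then consider "\<forall>j\<in>{1..n}. interval_Z (\<pi> ` {1..j})" | "\<forall>j\<in>{1..n}. interval_Z (\<pi> ` {j..n})"
      by (auto simp: unimodal_perms_def)
    then show False
    proof cases
      case 1
      \<comment> \<open>The new value cannot fall between \<open>\<pi> i\<close> and the extreme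
        value \<open>\<pi> s\<close>, both of which already lie in the interval, so it moves away
        from \<open>\<pi> s\<close>.\<close>
      have "i \<in> Des_perm n \<pi> \<longleftrightarrow> \<pi> s = n" if i: "i \<in> {s..n - 1}" for i
      proof -
        have "interval_Z (\<pi> ` {1..i})" using 1 i s by auto
        moreover have "\<pi> (i + 1) \<notin> \<pi> ` {1..i}" using injD[OF inj] by fastforce
        moreover have mem: "\<pi> i \<in> \<pi> ` {1..i}" "\<pi> s \<in> \<pi> ` {1..i}" using i s by auto
        ultimately have nb: "\<not> (\<pi> i \<le> \<pi> (i + 1) \<and> \<pi> (i + 1) \<le> \<pi> s)"
          "\<not> (\<pi> s \<le> \<pi> (i + 1) \<and> \<pi> (i + 1) \<le> \<pi> i)"
          using interval_Z_between by blast+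
        have "\<pi> (i + 1) \<in> {1..n}" using i s val[of "i + 1"] by auto
        moreover have "\<pi> s = 1 \<or> \<pi> s = n" "n \<noteq> 1" using split tn s by (auto simp: split_arc_perm_def)
        moreover have "i \<in> Des_perm n \<pi> \<longleftrightarrow> \<pi> (i + 1) < \<pi> i"
          using i s by (auto simp: Des_perm_def)
        ultimately show ?thesis using nb by auto
      qed
      moreover have "t \<in> {s..n - 1}" "t - 1 \<in> {s..n - 1}" using t tn by auto
      ultimately show False using t(1) by (auto simp: changes_def)
    next
      case 2
      have proper: "i = s" if "i \<in> {1..s}" "\<pi> i \<in> {1, n}" for i
        using split_arc_perm_prefix_proper[OF split] that s tn by auto
      have "x \<in> \<pi> ` {s..n}" if "x \<in> {1, n}" for x
      proof -
        have "x \<in> \<pi> ` {1..n}" using that permutes_image[OF perm] tn by auto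
        then obtain i where i: "i \<in> {1..n}" "\<pi> i = x" by blast
        then have "i \<ge> s" using proper[of i] that by (cases "i \<le> s") auto
        then show ?thesis using i by auto
      qed
      moreover have "\<pi> ` {s..n} \<subseteq> {1..n}" using val s by force
      moreover have "interval_Z (\<pi> ` {s..n})" using 2 s tn by auto
      ultimately have "\<pi> ` {s..n} = {1..n}" by (intro interval_Z_full) auto
      then have "\<pi> 1 \<in> \<pi> ` {s..n}" using val[of 1] tn by auto
      then show False using injD[OF inj] s by fastforce
    qed
  qed
  then show ?thesis using split_arc_perm_in_arc_perms[OF split] by (simp add: nonunimodal_arc_perms_def)
qed

text \<open>Failure of the suffix condition makes \<open>s\<close> differ from \<open>1\<close>;
  failure of the prefix condition makes the other extreme value occur before position
  \<open>n\<close>. The latter forces a change after \<open>s\<close>.\<close>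

lemma nonunimodal_imp_split:
  assumes "\<pi> \<in> nonunimodal_arc_perms n" "n \<ge> 2"
  shows "\<exists>s t. split_arc_perm n s \<pi> \<and> s \<in> changes n (Des_perm n \<pi>) \<and>
    t \<in> changes n (Des_perm n \<pi>) \<and> s < t"
proof -
  have perm: "\<pi> permutes {1..n}" and arc: "\<And>j. j \<in> {1..n} \<Longrightarrow> interval_Zn n (\<pi> ` {1..j})"
    and nonuni: "\<pi> \<notin> unimodal_perms n"
    using assms by (auto simp: nonunimodal_arc_perms_def arc_perms_def)
  have inj: "inj \<pi>" using perm by (rule permutes_inj)
  have val: "\<pi> i \<in> {1..n}" if "i \<in> {1..n}" for i using permutes_in_image[OF perm] that by blast
  \<comment> \<open>The first position of an extreme value.\<close>
  define s where "s = (LEAST j. \<pi> j \<in> {1, n})"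
  have "1 \<in> \<pi> ` {1..n}" using permutes_image[OF perm] assms by auto
  then obtain i where i: "i \<in> {1..n}" "\<pi> i \<in> {1, n}" by auto
  have \<pi>s: "\<pi> s \<in> {1, n}" unfolding s_def using i(2) by (rule LeastI)
  then have "s \<in> {1..n}" using permutes_in_image[OF perm, of s] assms by auto
  have before: "\<pi> j \<notin> {1, n}" if "j < s" for j
    using that not_less_Least unfolding s_def by blast
  have prefix: "interval_Z (\<pi> ` {1..j})" if j: "j \<in> {1..s}" for j
  proof (rule interval_Zn_cases)
    show "interval_Zn n (\<pi> ` {1..j})" using arc j \<open>s \<in> {1..n}\<close> by auto
    show "1 \<notin> \<pi> ` {1..j} \<or> n \<notin> \<pi> ` {1..j}"
    proof (rule ccontr)
      assume "\<not> ?thesis"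
      then obtain p q where pq: "p \<in> {1..j}" "\<pi> p = 1" "q \<in> {1..j}" "\<pi> q = n"
        by (metis imageE)
      then have "p = s" "q = s" using before[of p] before[of q] j by fastforce+
      then show False using pq assms(2) by simp
    qed
  qed
  have suffix: "interval_Z (\<pi> ` {j..n})" if j: "j \<in> {s + 1..n}" for j
  proof -
    have "interval_Z ({1..n} - \<pi> ` {1..j - 1})"
    proof (rule interval_Zn_compl_cases)
      have "\<pi> s \<in> \<pi> ` {1..j - 1}" using j \<open>s \<in> {1..n}\<close> by auto
      then show "1 \<in> \<pi> ` {1..j - 1} \<or> n \<in> \<pi> ` {1..j - 1}" using \<pi>s by auto
      have "j - 1 \<in> {1..n}" using j \<open>s \<in> {1..n}\<close> by auto
      then show "interval_Zn n (\<pi> ` {1..j - 1})" by (rule arc)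
      show "\<pi> ` {1..j - 1} \<noteq> {1..n}"
        using permutes_prefix(2)[OF perm, of "j - 1"] j by fastforce
    qed
    moreover have "j - 1 \<le> n" "j - 1 + 1 = j" using j by auto
    ultimately show ?thesis using permutes_suffix[OF perm, of "j - 1"] by simp
  qed
  have split: "split_arc_perm n s \<pi>"
    using perm \<pi>s prefix suffix by (simp add: split_arc_perm_def)
  \<comment> \<open>For \<open>s = 1\<close> the suffixes after \<open>s\<close> together with the
    whole set would make \<open>\<pi>\<close> unimodal.\<close>
  have "s \<noteq> 1"
  proof
    assume "s = 1"
    then have "interval_Z (\<pi> ` {j..n})" if "j \<in> {1..n}" for j
      using suffix[of j] that permutes_image[OF perm] assms(2)
      by (cases "j = 1") (auto intro: interval_Z_intro)
    then show False using nonuni perm by (auto simp: unimodal_perms_def)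
  qed
  have "\<exists>j\<in>{1..n}. \<not> interval_Z (\<pi> ` {1..j})" using nonuni perm by (auto simp: unimodal_perms_def)
  then obtain j where j: "j \<in> {1..n}" "\<not> interval_Z (\<pi> ` {1..j})" by blast
  have "j > s" using prefix[of j] j by force
  have "j \<noteq> n"
    using j permutes_image[OF perm] interval_Z_intro[of 1 n] by auto
  \<comment> \<open>An arc that is not an integer interval wraps around, hence contains both extreme
    values.\<close>
  have both: "1 \<in> \<pi> ` {1..j}" "n \<in> \<pi> ` {1..j}"
    using interval_Zn_cases[OF arc[OF j(1)]] j(2) by auto
  have sn: "2 \<le> s" "s \<le> n - 2" using \<open>s \<noteq> 1\<close> \<open>s \<in> {1..n}\<close> \<open>j > s\<close> \<open>j \<noteq> n\<close> j(1) by auto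
  have Des: "i \<in> Des_perm n \<pi> \<longleftrightarrow> \<pi> (i + 1) < \<pi> i" if "i \<in> {1..n - 1}" for i
    using that by (auto simp: Des_perm_def)
  have asc: "i \<notin> Des_perm n \<pi> \<longleftrightarrow> \<pi> i < \<pi> (i + 1)" if "i \<in> {1..n - 1}" for i
    using Des[OF that] injD[OF inj, of i "i + 1"] by force
  have s_Des: "s \<in> Des_perm n \<pi> \<longleftrightarrow> \<pi> s = n"
  proof -
    have m: "s \<in> {1..n - 1}" "s + 1 \<in> {1..n}" using sn by auto
    show ?thesis using Des[OF m(1)] asc[OF m(1)] val[OF m(2)] \<pi>s by auto
  qed
  have s1_Des: "s - 1 \<in> Des_perm n \<pi> \<longleftrightarrow> \<pi> s \<noteq> n"
  proof -
    have m: "s - 1 \<in> {1..n - 1}" "s - 1 \<in> {1..n}" "s - 1 + 1 = s" using sn by auto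
    show ?thesis using Des[OF m(1)] asc[OF m(1)] val[OF m(2)] \<pi>s unfolding m(3) by auto
  qed
  text \<open>The element \<open>e\<close> of \<open>{1, n}\<close> other than \<open>\<pi> s\<close> sits at a position \<open>p < n\<close>, and the step
    after \<open>p\<close> runs in the direction opposite to the step after \<open>s\<close>.\<close>
  define e where "e = (if \<pi> s = n then 1 else n)"
  have "e \<in> \<pi> ` {1..j}" using both by (auto simp: e_def)
  then obtain p where p: "p \<in> {1..j}" "\<pi> p = e" by blast
  have "p \<noteq> s" using p \<pi>s assms(2) by (auto simp: e_def split: if_splits)
  moreover have "\<not> p < s" using before[of p] p by (auto simp: e_def split: if_splits)
  ultimately have "s < p" by simp
  have pn: "p \<in> {1..n - 1}" "p + 1 \<in> {1..n}" using p j \<open>j \<noteq> n\<close> by auto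
  have "p \<in> Des_perm n \<pi> \<longleftrightarrow> \<pi> s \<noteq> n"
    using Des[OF pn(1)] asc[OF pn(1)] val[OF pn(2)] p \<pi>s by (auto simp: e_def split: if_splits)
  then obtain t where "t \<in> changes n (Des_perm n \<pi>)" "s < t"
    using change_between[of s p n "Des_perm n \<pi>"] s_Des sn pn \<open>s < p\<close> by auto
  moreover have "s \<in> changes n (Des_perm n \<pi>)"
    using s_Des s1_Des sn by (auto simp: changes_def)
  ultimately show ?thesis using split by blast
qed

section \<open>Summation over non-unimodal arc permutations\<close>

lemma sum_nonunimodal_arc_perms:
  assumes "n \<ge> 2"
  shows "(\<Sum>\<pi>\<in>nonunimodal_arc_perms n. F (Des_perm n \<pi>)) =
    (\<Sum>(D, s)\<in>(SIGMA D:Pow {1..n - 1}. {s \<in> changes n D. \<exists>t\<in>changes n D. s < t}). F D)"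
    (is "?lhs = _")
proof -
  define I where "I = (SIGMA D:Pow {1..n - 1}. {s \<in> changes n D. \<exists>t\<in>changes n D. s < t})"
  have I: "(D, s) \<in> I \<longleftrightarrow> D \<subseteq> {1..n - 1} \<and> s \<in> changes n D \<and> (\<exists>t\<in>changes n D. s < t)" for D s
    by (auto simp: I_def)
  have "\<exists>\<pi>. split_arc_perm n s \<pi> \<and> Des_perm n \<pi> = D" if "(D, s) \<in> I" for D s
    using that by (intro split_arc_perm_exists) (auto simp: I changes_def)
  \<comment> \<open>\<open>h D s\<close> is a chosen split permutation with these data. It is
    injective because \<open>D\<close> and \<open>s\<close> can be read off from it, and it hits
    everything because the permutation with these data is unique.\<close>
  then obtain h where h: "\<And>D s. (D, s) \<in> I \<Longrightarrow> split_arc_perm n s (h D s) \<and> Des_perm n (h D s) = D"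
    by metis
  have "bij_betw (\<lambda>(D, s). h D s) I (nonunimodal_arc_perms n)"
  proof (rule bij_betw_imageI)
    show "inj_on (\<lambda>(D, s). h D s) I"
    proof (clarsimp simp: inj_on_def)
      fix D s D' s' assume A: "(D, s) \<in> I" "(D', s') \<in> I" "h D s = h D' s'"
      have "s \<in> {1..<n}" "s' \<in> {1..<n}" using A(1,2) by (auto simp: I changes_def)
      then show "D = D' \<and> s = s'"
        using h[OF A(1)] h[OF A(2)] A(3) split_arc_perm_position_unique by metis
    qed
    show "(\<lambda>(D, s). h D s) ` I = nonunimodal_arc_perms n"
    proof (intro subset_antisym subsetI)
      fix \<pi> assume "\<pi> \<in> (\<lambda>(D, s). h D s) ` I"
      then obtain D s where Ds: "(D, s) \<in> I" "\<pi> = h D s" by auto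
      then obtain t where "t \<in> changes n (Des_perm n \<pi>)" "s < t" using h I by metis
      moreover have "2 \<le> s" using Ds(1) by (simp add: I changes_def)
      ultimately show "\<pi> \<in> nonunimodal_arc_perms n"
        using split_arc_perm_nonunimodal h[OF Ds(1)] Ds(2) by blast
    next
      fix \<pi> assume "\<pi> \<in> nonunimodal_arc_perms n"
      then obtain s t where st: "split_arc_perm n s \<pi>" "s \<in> changes n (Des_perm n \<pi>)"
          "t \<in> changes n (Des_perm n \<pi>)" "s < t"
        using nonunimodal_imp_split assms by blast
      have "Des_perm n \<pi> \<subseteq> {1..n - 1}" by (auto simp: Des_perm_def)
      with st have mem: "(Des_perm n \<pi>, s) \<in> I" by (auto simp: I)
      have "2 \<le> s" "s + 1 \<le> n" "(s - 1 \<in> Des_perm n \<pi>) \<noteq> (s \<in> Des_perm n \<pi>)"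
        using st(2) by (auto simp: changes_def)
      then have "h (Des_perm n \<pi>) s = \<pi>"
        using split_arc_perm_unique st(1) h[OF mem] by blast
      then show "\<pi> \<in> (\<lambda>(D, s). h D s) ` I" using mem by force
    qed
  qed
  then have "?lhs = (\<Sum>x\<in>I. F (Des_perm n ((\<lambda>(D, s). h D s) x)))"
    by (rule sum.reindex_bij_betw[symmetric])
  also have "\<dots> = (\<Sum>(D, s)\<in>I. F D)" using h by (intro sum.cong) auto
  finally show ?thesis by (simp add: I_def)
qed

subsection \<open>Tableaux\<close>

text \<open>The recursive form lets the column condition be unfolded row by row on an explicit list
  of rows.\<close>

fun columns_increasing :: "nat list list \<Rightarrow> bool" where
  "columns_increasing (a # b # T) \<longleftrightarrow> (\<forall>c<length b. a ! c < b ! c) \<and> columns_increasing (b # T)"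
| "columns_increasing T \<longleftrightarrow> True"

lemma columns_increasing_iff_nth:
  "columns_increasing T \<longleftrightarrow>
    (\<forall>r. r + 1 < length T \<longrightarrow> (\<forall>c<length (T ! (r + 1)). T ! r ! c < T ! (r + 1) ! c))"
proof (induction T rule: columns_increasing.induct)
  case (1 a b T)
  have split: "(\<forall>r. P r) \<longleftrightarrow> P 0 \<and> (\<forall>r. P (Suc r))" for P :: "nat \<Rightarrow> bool"
    by (metis not0_implies_Suc)
  show ?case by (subst split) (use 1 in simp)
qed auto

lemma standard_tableaux_iff:
  "T \<in> standard_tableaux shape \<longleftrightarrow> map length T = shape \<and> distinct (concat T) \<and>
    set (concat T) = {1..sum_list shape} \<and> (\<forall>row\<in>set T. sorted_wrt (<) row) \<and> columns_increasing T"
proof -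
  have "sorted_wrt (<) row \<longleftrightarrow> (\<forall>c. c + 1 < length row \<longrightarrow> row ! c < row ! (c + 1))" for row :: "nat list"
    by (subst sorted_wrt_iff_nth_Suc_transp) auto
  then show ?thesis
    unfolding standard_tableaux_def columns_increasing_iff_nth all_set_conv_all_nth by blast
qed

text \<open>Below the top row only the first column exists, so the column condition reduces to one
  chain starting at \<open>hd row\<close>.\<close>

lemma columns_increasing_singletons:
  assumes "row \<noteq> []"
  shows "columns_increasing (row # map (\<lambda>y. [y]) cs) \<longleftrightarrow> sorted_wrt (<) (hd row # cs)"
  using assms
proof (induction cs arbitrary: row)
  case (Cons c cs)
  then have "columns_increasing (row # map (\<lambda>y. [y]) (c # cs)) \<longleftrightarrow>
    hd row < c \<and> sorted_wrt (<) (c # cs)"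
    by (simp add: hd_conv_nth)
  then show ?case by fastforce
qed simp

text \<open>The corner of a standard tableau must hold \<open>1\<close>. The rest of the first row
  is \<open>r\<close>, the rest of the first column is \<open>c # cs\<close>, and \<open>x\<close>
  sits in cell (2,2).\<close>

definition near_hook :: "nat list \<Rightarrow> nat \<Rightarrow> nat \<Rightarrow> nat list \<Rightarrow> nat list list" where
  "near_hook r c x cs = (1 # r) # [c, x] # map (\<lambda>y. [y]) cs"

text \<open>Here \<open>r \<noteq> []\<close> encodes \<open>k \<ge> 2\<close>,
  \<open>hd r < x\<close> is the second column and \<open>c < x\<close> the second row.\<close>

definition near_hook_filling :: "nat \<Rightarrow> nat list \<Rightarrow> nat \<Rightarrow> nat \<Rightarrow> nat list \<Rightarrow> bool" where
  "near_hook_filling n r c x cs \<longleftrightarrow> r \<noteq> [] \<and> sorted_wrt (<) (1 # r) \<and> sorted_wrt (<) (1 # c # cs) \<and>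
     hd r < x \<and> c < x \<and> distinct (r @ c # x # cs) \<and> set (1 # r @ c # x # cs) = {1..n}"

lemma concat_singletons [simp]: "concat (map (\<lambda>y. [y]) cs) = cs"
  by (induction cs) auto

lemma near_hook_in_tableaux_T:
  assumes "near_hook_filling n r c x cs"
  shows "near_hook r c x cs \<in> tableaux_T n"
proof -
  have "distinct (1 # r @ c # x # cs)" using assms by (auto simp: near_hook_filling_def)
  then have "length (1 # r @ c # x # cs) = card {1..n}"
    using assms by (metis distinct_card near_hook_filling_def)
  \<comment> \<open>Counting entries places \<open>k = length r + 1\<close> in
    \<open>{2..n - 2}\<close> and matches the number of singleton rows with the shape.\<close>
  then have n: "n = length r + length cs + 3" by simp
  have "r \<noteq> []" using assms by (simp add: near_hook_filling_def)
  then have r: "length r \<ge> 1" by (cases r) auto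
  have "columns_increasing ([c, x] # map (\<lambda>y. [y]) cs)"
    using assms by (subst columns_increasing_singletons) (auto simp: near_hook_filling_def)
  then have "columns_increasing (near_hook r c x cs)"
    using assms by (auto simp: near_hook_def near_hook_filling_def less_Suc_eq hd_conv_nth)
  moreover have "map length (near_hook r c x cs) = (length r + 1) # 2 # replicate (length cs) 1"
    by (induction cs) (auto simp: near_hook_def)
  moreover have "\<forall>row\<in>set (near_hook r c x cs). sorted_wrt (<) row"
    using assms by (auto simp: near_hook_def near_hook_filling_def)
  moreover have "distinct (concat (near_hook r c x cs))" "set (concat (near_hook r c x cs)) = {1..n}"
    using assms by (auto simp: near_hook_def near_hook_filling_def)
  moreover have "sum_list ((length r + 1) # 2 # replicate (length cs) 1) = n"
    by (simp add: n sum_list_replicate)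
  moreover have "n - (length r + 1) - 2 = length cs" using n by simp
  ultimately have "near_hook r c x cs \<in> standard_tableaux ((length r + 1) # 2 # replicate (n - (length r + 1) - 2) 1)"
    by (simp only: standard_tableaux_iff simp_thms)
  moreover have "length r + 1 \<in> {2..n - 2}" using n r by auto
  ultimately show ?thesis unfolding tableaux_T_def by blast
qed

lemma tableaux_T_obtain:
  assumes "T \<in> tableaux_T n"
  obtains r c x cs where "T = near_hook r c x cs" "near_hook_filling n r c x cs"
proof -
  obtain k where k: "k \<in> {2..n - 2}" "T \<in> standard_tableaux (k # 2 # replicate (n - k - 2) 1)"
    using assms by (auto simp: tableaux_T_def)
  then have T: "map length T = k # 2 # replicate (n - k - 2) 1" "distinct (concat T)"
    "set (concat T) = {1..n}" "\<forall>row\<in>set T. sorted_wrt (<) row" "columns_increasing T"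
    by (auto simp: standard_tableaux_iff sum_list_replicate)
  obtain row1 row2 T' where rows: "T = row1 # row2 # T'" "length row1 = k" "length row2 = 2"
    "map length T' = replicate (n - k - 2) 1"
    using T(1) by (auto simp: map_eq_Cons_conv)
  obtain c x where row2: "row2 = [c, x]" using rows(3) by (auto simp: length_Suc_conv numeral_2_eq_2)
  obtain a r where row1: "row1 = a # r" "r \<noteq> []"
    using rows(2) k(1) by (cases row1; cases "tl row1") auto
  have "length row = 1" if "row \<in> set T'" for row
    using that arg_cong[OF rows(4), of set] by (auto split: if_splits)
  then have "\<forall>row\<in>set T'. \<exists>y. row = [y]" by (simp add: length_Suc_conv)
  then obtain cs where cs: "T' = map (\<lambda>y. [y]) cs" by (auto simp: ex_map_conv[symmetric])
  have sorted: "sorted_wrt (<) (a # r)" "c < x" using T(4) rows row1 row2 by auto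
  have "\<forall>i<2. row1 ! i < row2 ! i" "columns_increasing (row2 # T')"
    using T(5) unfolding rows(1) row2 by auto
  then have col: "a < c" "hd r < x" "sorted_wrt (<) (c # cs)"
    using row1 columns_increasing_singletons[of row2 cs]
    by (auto simp: row2 cs hd_conv_nth numeral_2_eq_2)
  \<comment> \<open>The corner entry \<open>a\<close> is minimal among the entries
    \<open>{1..n}\<close>, so it equals \<open>1\<close>.\<close>
  have set: "set (a # r @ c # x # cs) = {1..n}" using T(3) by (simp add: rows row1 row2 cs)
  moreover have "1 \<in> {1..n}" using k(1) by auto
  ultimately have "1 \<in> set (a # r @ c # x # cs)" by blast
  moreover have "\<forall>y\<in>set (a # r @ c # x # cs). a \<le> y" using sorted col by auto
  ultimately have "a \<le> 1" by blast
  moreover have "1 \<le> a" using set by (metis atLeastAtMost_iff list.set_intros(1))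
  ultimately have a: "a = 1" by simp
  have "near_hook_filling n r c x cs"
    using sorted col set T(2) row1
    by (auto simp: near_hook_filling_def a rows row2 cs)
  moreover have "T = near_hook r c x cs" by (simp add: near_hook_def rows row1 row2 cs a)
  ultimately show thesis using that by blast
qed

section \<open>Descents of near-hook tableaux\<close>

lemma Des_tab_Nil [simp]: "Des_tab [] = {}"
  by (simp add: Des_tab_def)

lemma Des_tab_Cons: "Des_tab (row # T) = {i \<in> set row. i + 1 \<in> set (concat T)} \<union> Des_tab T"
proof (intro set_eqI iffI)
  fix i assume "i \<in> Des_tab (row # T)"
  then obtain r s where rs: "r < s" "s < length (row # T)" "i \<in> set ((row # T) ! r)"
      "i + 1 \<in> set ((row # T) ! s)"
    by (auto simp: Des_tab_def)
  then obtain s' where s': "s = Suc s'" by (cases s) auto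
  show "i \<in> {i \<in> set row. i + 1 \<in> set (concat T)} \<union> Des_tab T"
  proof (cases r)
    case 0
    then show ?thesis using rs s' by (auto intro!: bexI[of _ "T ! s'"])
  next
    case (Suc r')
    then show ?thesis using rs s' by (auto simp: Des_tab_def)
  qed
next
  fix i assume "i \<in> {i \<in> set row. i + 1 \<in> set (concat T)} \<union> Des_tab T"
  then show "i \<in> Des_tab (row # T)"
  proof
    assume "i \<in> {i \<in> set row. i + 1 \<in> set (concat T)}"
    then obtain row' where "row' \<in> set T" "i + 1 \<in> set row'" "i \<in> set row" by auto
    then obtain s where "s < length T" "i + 1 \<in> set (T ! s)" "i \<in> set row"
      by (metis in_set_conv_nth)
    then show ?thesis unfolding Des_tab_def by (intro CollectI exI[of _ 0] exI[of _ "Suc s"]) auto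
  next
    assume "i \<in> Des_tab T"
    then obtain r s where "r < s" "s < length T" "i \<in> set (T ! r)" "i + 1 \<in> set (T ! s)"
      by (auto simp: Des_tab_def)
    then show ?thesis unfolding Des_tab_def by (intro CollectI exI[of _ "Suc r"] exI[of _ "Suc s"]) auto
  qed
qed

text \<open>In an increasing column \<open>i + 1\<close> automatically lies below
  \<open>i\<close>.\<close>

lemma Des_tab_singletons:
  "sorted_wrt (<) cs \<Longrightarrow> Des_tab (map (\<lambda>y. [y]) cs) = {i \<in> set cs. i + 1 \<in> set cs}"
  by (induction cs) (auto simp: Des_tab_Cons)

text \<open>The position of \<open>i + 1\<close> decides. In the first row it never gives a descent;
  in the first column below the corner it always does, as all smaller entries lie higher up. Only
  for \<open>i + 1 = x\<close> does the place of \<open>i\<close> matter.\<close>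

lemma Des_tab_near_hook:
  assumes "near_hook_filling n r c x cs"
  shows "i \<in> Des_tab (near_hook r c x cs) \<longleftrightarrow>
    i \<in> {1..n - 1} \<and> (if i + 1 = x then i \<in> set r else i + 1 \<in> set (c # cs))"
proof -
  have sorted: "sorted_wrt (<) (1 # r)" "sorted_wrt (<) (1 # c # cs)" "c < x"
    and dist: "distinct (r @ c # x # cs)" and set: "set (1 # r @ c # x # cs) = {1..n}"
    using assms by (auto simp: near_hook_filling_def)
  have Des: "Des_tab (near_hook r c x cs) = {i \<in> set (1 # r). i + 1 \<in> {c, x} \<union> set cs} \<union>
      {i \<in> {c, x}. i + 1 \<in> set cs} \<union> {i \<in> set cs. i + 1 \<in> set cs}"
    using sorted by (simp add: near_hook_def Des_tab_Cons Des_tab_singletons Un_assoc)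
  show ?thesis
  proof (cases "i \<in> {1..n - 1}")
    case True
    then have "i \<in> {1..n}" "i + 1 \<in> {1..n}" by auto
    then have "i \<in> set (1 # r @ c # x # cs)" "i + 1 \<in> set (1 # r @ c # x # cs)"
      unfolding set by auto
    then show ?thesis using True sorted dist unfolding Des by auto
  next
    case False
    have "\<not> (i \<in> {1..n} \<and> i + 1 \<in> {1..n})" using False by auto
    then have "\<not> (i \<in> set (1 # r @ c # x # cs) \<and> i + 1 \<in> set (1 # r @ c # x # cs))"
      unfolding set by auto
    then show ?thesis using False unfolding Des by auto
  qed
qed

text \<open>Reads the descent criterion backwards: every \<open>y\<close> other than
  \<open>1\<close> and \<open>x\<close> belongs to the column or to the row according to whether
  \<open>y - 1\<close> is a descent. So the descent set and \<open>x\<close> determine the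
  tableau.\<close>

lemma near_hook_sets:
  assumes "near_hook_filling n r c x cs"
  defines "D \<equiv> Des_tab (near_hook r c x cs)"
  shows "set (c # cs) = {y \<in> {2..n} - {x}. y - 1 \<in> D}" "set r = {y \<in> {2..n} - {x}. y - 1 \<notin> D}"
    "3 \<le> x" "x \<le> n" "x - 1 \<in> D \<longleftrightarrow> x - 1 \<in> set r"
proof -
  have sorted: "sorted_wrt (<) (1 # r)" "sorted_wrt (<) (1 # c # cs)" "c < x"
    and dist: "distinct (r @ c # x # cs)" and set: "set (1 # r @ c # x # cs) = {1..n}"
    using assms by (auto simp: near_hook_filling_def)
  note Des = Des_tab_near_hook[OF assms(1), folded D_def]
  have "1 < c" using sorted by simp
  then show x: "3 \<le> x" using sorted(3) by linarith
  show "x \<le> n" using set by auto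
  then show "x - 1 \<in> D \<longleftrightarrow> x - 1 \<in> set r" using Des[of "x - 1"] x by auto
  have "1 \<notin> set (r @ c # x # cs)" using sorted by auto
  then have "set (r @ c # x # cs) = {1..n} - {1}" using set by auto
  also have "\<dots> = {2..n}" by auto
  finally have set2: "set (r @ c # x # cs) = {2..n}" .
  have step: "y - 1 \<in> D \<longleftrightarrow> y \<in> set (c # cs)" if "y \<in> {2..n} - {x}" for y
    using Des[of "y - 1"] that by auto
  have "set (c # cs) \<subseteq> {2..n} - {x}" "set r = {2..n} - {x} - set (c # cs)"
    using dist unfolding set2[symmetric] by auto
  then show "set (c # cs) = {y \<in> {2..n} - {x}. y - 1 \<in> D}" "set r = {y \<in> {2..n} - {x}. y - 1 \<notin> D}"
    using step by blast+
qed

lemma near_hook_unique: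
  assumes "near_hook_filling n r c x cs" "near_hook_filling n r' c' x cs'"
    and "Des_tab (near_hook r c x cs) = Des_tab (near_hook r' c' x cs')"
  shows "near_hook r c x cs = near_hook r' c' x cs'"
proof -
  have "c # cs = c' # cs'"
    using near_hook_sets(1)[OF assms(1)] near_hook_sets(1)[OF assms(2)] assms
    by (intro strict_sorted_equal) (auto simp: near_hook_filling_def)
  moreover have "r = r'"
    using near_hook_sets(2)[OF assms(1)] near_hook_sets(2)[OF assms(2)] assms
    by (intro strict_sorted_equal) (auto simp: near_hook_filling_def)
  ultimately show ?thesis by simp
qed

text \<open>The entry \<open>x - 1\<close> lies in \<open>r\<close> iff \<open>x - 2\<close> is not
  a descent, but also iff \<open>x - 1\<close> is a descent; hence \<open>x - 1\<close> is a change.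
  An earlier change lies between \<open>hd r - 1\<close>, which is no descent, and
  \<open>c - 1\<close>, which is one.\<close>

lemma near_hook_change:
  assumes f: "near_hook_filling n r c x cs"
  defines "D \<equiv> Des_tab (near_hook r c x cs)"
  shows "x - 1 \<in> changes n D \<and> (\<exists>t\<in>changes n D. t < x - 1)"
proof -
  note sets = near_hook_sets[OF f, folded D_def]
  have r: "hd r \<in> set r" "hd r < x" and c: "c \<in> set (c # cs)" "c < x"
    using f by (auto simp: near_hook_filling_def)
  have hd: "hd r \<in> {2..n}" "hd r - 1 \<notin> D" using r sets(2) by auto
  have c': "c \<in> {2..n}" "c - 1 \<in> D" using c(1) unfolding sets(1) by auto
  have "x - 1 \<in> {2..n} - {x}" "x - 1 - 1 = x - 2" using sets(3,4) by auto
  then have "x - 1 \<in> set r \<longleftrightarrow> x - 2 \<notin> D" using sets(2) by auto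
  then have "x - 1 \<in> changes n D" using sets(3-5) by (auto simp: changes_def numeral_2_eq_2)
  moreover have "\<exists>t\<in>changes n D. t < x - 1"
  proof (cases "hd r < c")
    case True
    have "\<exists>t\<in>changes n D. hd r - 1 < t \<and> t \<le> c - 1"
      using hd c' c True sets(4) by (intro change_between) auto
    moreover have "c - 1 < x - 1" using c c' by auto
    ultimately show ?thesis using le_less_trans by blast
  next
    case False
    then have "c < hd r" using hd c' by (metis linorder_neqE_nat)
    then have "\<exists>t\<in>changes n D. c - 1 < t \<and> t \<le> hd r - 1"
      using hd c' r sets(4) by (intro change_between) auto
    moreover have "hd r - 1 < x - 1" using r hd by auto
    ultimately show ?thesis using le_less_trans by blast
  qed
  ultimately show ?thesis by blast
qed

lemma near_hook_exists:
  assumes D: "D \<subseteq> {1..n - 1}" and t: "t \<in> changes n D" "t' \<in> changes n D" "t' < t"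
  shows "\<exists>r c cs. near_hook_filling n r c (t + 1) cs \<and> Des_tab (near_hook r c (t + 1) cs) = D"
proof -
  define C where "C = {y \<in> {2..n} - {t + 1}. y - 1 \<in> D}"
  define R where "R = {y \<in> {2..n} - {t + 1}. y - 1 \<notin> D}"
  have tn: "t \<le> n - 1" "2 \<le> t" "2 \<le> t'" using t by (auto simp: changes_def)
  have mem: "t' \<in> {2..n} - {t + 1}" "t' + 1 \<in> {2..n} - {t + 1}" using t tn by auto
  \<comment> \<open>Both \<open>hd r\<close> and \<open>c\<close> must end up below
    \<open>t + 1\<close>. The earlier change \<open>t'\<close> puts \<open>t'\<close> and
    \<open>t' + 1\<close> into different sets among \<open>C\<close> and \<open>R\<close>, and both
    are at most \<open>t\<close>.\<close>
  obtain p q where pq: "p \<in> C" "q \<in> R" "p < t + 1" "q < t + 1"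
  proof (cases "t' \<in> D")
    case True
    then have "t' + 1 \<in> C" "t' \<in> R" using mem t(2) by (auto simp: C_def R_def changes_def)
    then show thesis using that t(3) by force
  next
    case False
    then have "t' \<in> C" "t' + 1 \<in> R" using mem t(2) by (auto simp: C_def R_def changes_def)
    then show thesis using that t(3) by force
  qed
  define r where "r = sorted_list_of_set R"
  have fin: "finite C" "finite R" by (auto simp: C_def R_def)
  have r: "set r = R" "sorted_wrt (<) r" using fin by (auto simp: r_def)
  have "set (sorted_list_of_set C) = C" "sorted_wrt (<) (sorted_list_of_set C)" using fin by auto
  moreover have "sorted_list_of_set C \<noteq> []" using pq(1) fin by auto
  ultimately obtain c cs where c: "set (c # cs) = C" "sorted_wrt (<) (c # cs)"
    by (metis neq_Nil_conv)
  have "r \<noteq> []" using pq r by auto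
  then have "hd r \<le> q" using pq r by (cases r) auto
  moreover have "c \<le> p" using pq c by auto
  moreover have gt1: "\<forall>y\<in>R \<union> C. 1 < y" by (auto simp: C_def R_def)
  moreover have disj: "R \<inter> C = {}" "t + 1 \<notin> R \<union> C" by (auto simp: R_def C_def)
  moreover have "insert 1 (insert (t + 1) (R \<union> C)) = {1..n}"
    using tn unfolding R_def C_def by auto
  moreover have "distinct r" "distinct (c # cs)" using r c strict_sorted_iff by blast+
  ultimately have f: "near_hook_filling n r c (t + 1) cs"
    using pq r c \<open>r \<noteq> []\<close> by (auto simp: near_hook_filling_def)
  have "i \<in> Des_tab (near_hook r c (t + 1) cs) \<longleftrightarrow> i \<in> D" if i: "i \<in> {1..n - 1}" for i
  proof (cases "i = t")
    case True
    \<comment> \<open>For \<open>i + 1 = x\<close> the criterion asks whether \<open>t\<close> is in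
      the first row. Membership in \<open>R\<close> is defined through \<open>t - 1\<close>, and the
      change at \<open>t\<close> converts this into \<open>t \<in> D\<close>.\<close>
    have "t \<in> {2..n} - {t + 1}" using tn by auto
    then have "t \<in> R \<longleftrightarrow> t \<in> D" using t(1) by (auto simp: R_def changes_def)
    then show ?thesis using Des_tab_near_hook[OF f, of i] i True r by simp
  next
    case False
    have "i + 1 \<in> {2..n} - {t + 1}" using i False by auto
    then have "i + 1 \<in> C \<longleftrightarrow> i \<in> D" by (simp add: C_def)
    then show ?thesis using Des_tab_near_hook[OF f, of i] i False unfolding c(1) by simp
  qed
  moreover have "Des_tab (near_hook r c (t + 1) cs) \<subseteq> {1..n - 1}"
    using Des_tab_near_hook[OF f] by blast
  ultimately have "Des_tab (near_hook r c (t + 1) cs) = D" using D by blast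
  then show ?thesis using f by blast
qed

lemma sum_tableaux_T:
  shows "(\<Sum>T\<in>tableaux_T n. F (Des_tab T)) =
    (\<Sum>(D, s)\<in>(SIGMA D:Pow {1..n - 1}. {s \<in> changes n D. \<exists>t\<in>changes n D. t < s}). F D)"
proof -
  define I where "I = (SIGMA D:Pow {1..n - 1}. {s \<in> changes n D. \<exists>t\<in>changes n D. t < s})"
  have I: "(D, s) \<in> I \<longleftrightarrow> D \<subseteq> {1..n - 1} \<and> s \<in> changes n D \<and> (\<exists>t\<in>changes n D. t < s)" for D s
    by (auto simp: I_def)
  \<comment> \<open>With indices from 0, \<open>T ! 1 ! 1\<close> is the entry of cell
    (2,2).\<close>
  define h where "h T = (Des_tab T, T ! 1 ! 1 - 1)" for T
  have h: "h (near_hook r c x cs) = (Des_tab (near_hook r c x cs), x - 1)" for r c x cs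
    by (simp add: h_def near_hook_def)
  have "bij_betw h (tableaux_T n) I"
  proof (rule bij_betw_imageI)
    show "inj_on h (tableaux_T n)"
    proof
      fix T T' assume A: "T \<in> tableaux_T n" "T' \<in> tableaux_T n" "h T = h T'"
      obtain r c x cs where T: "T = near_hook r c x cs" "near_hook_filling n r c x cs"
        using A(1) by (rule tableaux_T_obtain)
      obtain r' c' x' cs' where T': "T' = near_hook r' c' x' cs'" "near_hook_filling n r' c' x' cs'"
        using A(2) by (rule tableaux_T_obtain)
      have "x - 1 = x' - 1" "Des_tab T = Des_tab T'" using A(3) by (auto simp: T(1) T'(1) h)
      \<comment> \<open>Keeps the truncated subtraction in \<open>x - 1 = x' - 1\<close>
        cancellable.\<close>
      moreover have "3 \<le> x" "3 \<le> x'" using near_hook_sets(3) T(2) T'(2) by blast+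
      ultimately have "x' = x" "Des_tab T = Des_tab T'" by auto
      then show "T = T'" using near_hook_unique T T' by metis
    qed
    show "h ` tableaux_T n = I"
    proof (intro subset_antisym subsetI)
      fix y assume "y \<in> h ` tableaux_T n"
      then obtain T where "T \<in> tableaux_T n" "y = h T" by blast
      then obtain r c x cs where T: "y = h (near_hook r c x cs)" "near_hook_filling n r c x cs"
        by (metis tableaux_T_obtain)
      have "Des_tab (near_hook r c x cs) \<subseteq> {1..n - 1}"
        using Des_tab_near_hook[OF T(2)] by blast
      then show "y \<in> I" using near_hook_change[OF T(2)] by (simp add: T(1) h I)
    next
      fix y assume "y \<in> I"
      then obtain D t t' where y: "y = (D, t)" "D \<subseteq> {1..n - 1}" "t \<in> changes n D" "t' \<in> changes n D" "t' < t"
        using I by (metis surj_pair)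
      obtain r c cs where "near_hook_filling n r c (t + 1) cs" "Des_tab (near_hook r c (t + 1) cs) = D"
        using near_hook_exists[OF y(2-5)] by blast
      then have "near_hook r c (t + 1) cs \<in> tableaux_T n" "h (near_hook r c (t + 1) cs) = y"
        by (auto simp: near_hook_in_tableaux_T h y(1))
      then show "y \<in> h ` tableaux_T n" by blast
    qed
  qed
  then have "(\<Sum>T\<in>tableaux_T n. F (fst (h T))) = (\<Sum>y\<in>I. F (fst y))"
    by (rule sum.reindex_bij_betw)
  then show ?thesis by (simp add: h_def I_def case_prod_beta)
qed

theorem theorem7p7:
  fixes n :: nat
  assumes "n \<ge> 4"
  shows "(\<Sum>T\<in>tableaux_T n. xpow (Des_tab T)) =
         (\<Sum>\<pi>\<in>nonunimodal_arc_perms n. xpow (Des_perm n \<pi>))"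
proof -
  have "n \<ge> 2" using assms by simp
  then show ?thesis
    unfolding sum_tableaux_T sum_nonlast_changes_eq by (rule sum_nonunimodal_arc_perms[symmetric])
qed

end
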